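(* Let $n\geq 1$, $a=[n,n+1,\ldots,n+5]$, $b=F_nF_{n+1}\cdots F_{n+5}$, and $c=(5,n)$. Then \[ z(b)=\begin{cases} ac, & \text{if } n\equiv 1,2,3,4,5,6\pmod{12}, \text{ or } n\equiv 7,8,59,60\pmod{72};\\ 2ac, & \text{if } n\equiv 9,10\pmod{12}, \text{ or } n\equiv 23,24,43,44\pmod{72};\\ 3ac, & \text{if } n\equiv 11,12,31,32,35,36,55,56\pmod{72};\\ 6ac, & \text{if } n\equiv 0,19,20,47,48,67,68,71\pmod{72}. \end{cases} \]
   Context: $F_n$ is the $n$th Fibonacci number ($F_1=F_2=1$, $F_n=F_{n-1}+F_{n-2}$). For a positive integer $m$, $z(m)$ is the smallest positive integer $k$ with $m\mid F_k$. $(\cdot,\cdot)$ denotes gcd and $[\cdots]$ lcm. *)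

theory Defs
  imports "HOL-Number_Theory.Number_Theory"
begin

(* For m > 0 the set over which the least element is taken is nonempty (every positive integer
   divides some positive-index Fibonacci number); for m = 0 the value is unspecified. *)
definition fib_order :: "nat \<Rightarrow> nat" where
  "fib_order m = (LEAST k. k > 0 \<and> m dvd fib k)"

end

theory Submission
  imports Defs
begin

text \<open>
  If the product divides \<open>fib m\<close>, then so does each factor \<open>fib i\<close>, which for \<open>i \<ge> 3\<close> forces \<open>i\<close>
  to divide \<open>m\<close> (and if 1 or 2 is in the range, so is 4); hence \<open>m = a * k\<close>. Since
  \<open>gcd (fib i) (fib j) = fib (gcd i j)\<close> with \<open>gcd i j \<le> 5\<close> for \<open>i \<noteq> j\<close>, only the primes 2, 3 and 5
  can divide two of the factors, so only at these primes can the product fail to divide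
  \<open>fib (a * k)\<close>. There the valuations of the Fibonacci numbers are known exactly: expanding
  \<open>fib (k * m)\<close> binomially in \<open>fib m\<close> and \<open>fib (m - 1)\<close> gives a lifting-the-exponent law, and
  comparing the sum of the six valuations with the maximum occurring in \<open>a\<close> tells which of 2, 3, 5
  must divide \<open>k\<close>.
\<close>

section \<open>Binomial expansion, divisibility among Fibonacci numbers, valuation of an lcm\<close>

text \<open>A root \<open>x\<close> of \<open>x * x = x + 1\<close> satisfies
  \<open>x ^ Suc q = fib (Suc q) * x + fib q\<close>. Raising this to the power \<open>k\<close> and
  combining the expansions at both roots by Binet's formula gives the identity.\<close>

lemma fib_mult_binomial:
  "fib (k * Suc q) = (\<Sum>j\<le>k. (k choose j) * fib (Suc q) ^ j * fib q ^ (k - j) * fib j)"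
proof -
  define \<phi> \<psi> :: real where "\<phi> = (1 + sqrt 5) / 2" and "\<psi> = (1 - sqrt 5) / 2"
  have pow: "x ^ Suc q = of_nat (fib (Suc q)) * x + of_nat (fib q)"
    if "x * x = x + 1" for x :: real
  proof (induction q)
    case (Suc q)
    have "x ^ Suc (Suc q) = fib (Suc q) * (x * x) + fib q * x"
      by (subst power_Suc, subst Suc.IH) (simp add: algebra_simps)
    then show ?case
      by (simp add: that algebra_simps)
  qed simp
  have roots: "\<phi> * \<phi> = \<phi> + 1" "\<psi> * \<psi> = \<psi> + 1"
    by (simp_all add: \<phi>_def \<psi>_def field_simps)
  have closed: "real (fib i) = (\<phi> ^ i - \<psi> ^ i) / sqrt 5" for i
    unfolding \<phi>_def \<psi>_def by (rule fib_closed_form)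
  have binom: "x ^ (k * Suc q) =
      (\<Sum>j\<le>k. real (k choose j) * real (fib (Suc q)) ^ j * real (fib q) ^ (k - j) * x ^ j)"
    if "x * x = x + 1" for x :: real
  proof -
    have "x ^ (k * Suc q) = (of_nat (fib (Suc q)) * x + of_nat (fib q)) ^ k"
      by (metis mult.commute pow[OF that] power_mult)
    then show ?thesis
      by (simp only: binomial_ring power_mult_distrib mult_ac)
  qed
  \<comment> \<open>Subtracting the expansions at \<open>\<phi>\<close> and \<open>\<psi>\<close>
    and dividing by \<open>sqrt 5\<close> turns each \<open>x ^ j\<close> into
    \<open>fib j\<close>.\<close>
  have "real (fib (k * Suc q)) =
      real (\<Sum>j\<le>k. (k choose j) * fib (Suc q) ^ j * fib q ^ (k - j) * fib j)"
    by (simp only: closed[of "k * Suc q"] binom[OF roots(1)] binom[OF roots(2)]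
        sum_subtractf[symmetric] sum_divide_distrib of_nat_sum of_nat_mult of_nat_power
        closed[of "_ :: nat"] right_diff_distrib times_divide_eq_right)
  then show ?thesis
    by (simp only: of_nat_eq_iff)
qed

lemma fib_dvd: "m dvd n \<Longrightarrow> fib m dvd fib n"
  by (metis fib_gcd gcd_nat.absorb1 gcd_dvd2)

text \<open>The hypothesis gives \<open>fib (gcd m n) = fib m\<close>, and all earlier values lie
  strictly below \<open>fib m\<close> once \<open>m \<ge> 3\<close>, so \<open>gcd m n = m\<close>.
  The bound excludes \<open>m = 2\<close>, where \<open>fib 2 = 1\<close> divides
  everything.\<close>

lemma fib_dvd_imp_dvd:
  assumes "fib m dvd fib n" "m \<ge> 3"
  shows "m dvd n"
proof -
  have less: "fib i < fib m" if "i < m" for i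
  proof -
    obtain j where j: "m = Suc (Suc (Suc j))"
      using le_Suc_ex[OF \<open>m \<ge> 3\<close>] by (auto simp: numeral_3_eq_3)
    have "fib i \<le> fib (Suc (Suc j))"
      using that j by (intro fib_mono) simp
    then show ?thesis
      using fib_neq_0_nat[of "Suc j"] j by simp
  qed
  have "fib (gcd m n) = fib m"
    using assms(1) by (simp add: fib_gcd gcd_nat.absorb1)
  moreover have "gcd m n \<le> m"
    using assms(2) by (intro gcd_le1_nat) simp
  ultimately have "gcd m n = m"
    using less[of "gcd m n"] by fastforce
  then show ?thesis
    by (metis gcd_dvd2)
qed

text \<open>Prime factorizations of an lcm are pointwise maxima; excluding 0 keeps the lcm
  nonzero.\<close>

lemma multiplicity_Lcm_nat:
  fixes A :: "nat set"
  assumes "prime p" "finite A" "A \<noteq> {}" "0 \<notin> A"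
  shows "multiplicity p (Lcm A) = Max (multiplicity p ` A)"
  using assms(2-)
proof (induction rule: finite_ne_induct)
  case (insert x A)
  then have nz: "x \<noteq> 0" "Lcm A \<noteq> 0"
    by (auto simp: Lcm_0_iff)
  have "multiplicity p (lcm x (Lcm A)) = count (prime_factorization (lcm x (Lcm A))) p"
    using assms(1) by (simp add: count_prime_factorization)
  also have "\<dots> = max (multiplicity p x) (multiplicity p (Lcm A))"
    using assms(1) nz by (simp add: prime_factorization_lcm count_prime_factorization)
  finally show ?case
    using insert by simp
qed simp

section \<open>Lifting the exponent\<close>

text \<open>In the binomial expansion the term \<open>j = 0\<close> vanishes because
  \<open>fib 0 = 0\<close>, the term \<open>j = 1\<close> is the main one, and the terms
  \<open>j \<ge> 2\<close> form an error divisible by \<open>d\<close> after one factor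
  \<open>fib (Suc q)\<close> is pulled out.\<close>

lemma fib_mult_split:
  assumes "k > 0"
    and "\<And>j. j \<in> {2..k} \<Longrightarrow> d dvd (k choose j) * fib (Suc q) ^ (j - 1) * fib q ^ (k - j) * fib j"
  obtains t where "fib (k * Suc q) = fib (Suc q) * (k * fib q ^ (k - 1) + d * t)"
proof -
  let ?f = "\<lambda>j. (k choose j) * fib (Suc q) ^ j * fib q ^ (k - j) * fib j"
  let ?g = "\<lambda>j. (k choose j) * fib (Suc q) ^ (j - 1) * fib q ^ (k - j) * fib j"
  have "{..k} = insert 0 (insert 1 {2..k})"
    using assms(1) by auto
  then have "fib (k * Suc q) = ?f 1 + sum ?f {2..k}"
    by (simp add: fib_mult_binomial del: mult_Suc_right)
  also have "sum ?f {2..k} = fib (Suc q) * sum ?g {2..k}"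
    unfolding sum_distrib_left
    by (intro sum.cong) (auto simp: power_eq_if[of _ "_ :: nat"])
  finally have "fib (k * Suc q) = fib (Suc q) * (k * fib q ^ (k - 1) + sum ?g {2..k})"
    by (simp add: algebra_simps)
  moreover have "d dvd sum ?g {2..k}"
    using assms(2) by (intro dvd_sum)
  then obtain t where "sum ?g {2..k} = d * t" ..
  ultimately show ?thesis
    using that by metis
qed

context
  fixes p q :: nat
  assumes p: "prime p" and dvd: "p dvd fib (Suc q)"
begin

lemma not_dvd_fib_pred: "\<not> p dvd fib q"
  using coprime_fib_Suc_nat[of q] p dvd by (meson not_prime_unit coprime_common_divisor)

text \<open>With \<open>d = p\<close> the cofactor of \<open>fib (Suc q)\<close> is congruent to
  \<open>k * fib q ^ (k - 1)\<close> modulo \<open>p\<close>, hence prime to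
  \<open>p\<close>.\<close>

lemma multiplicity_fib_mult_coprime:
  assumes "\<not> p dvd k"
  shows "multiplicity p (fib (k * Suc q)) = multiplicity p (fib (Suc q))"
proof -
  have "k > 0" using assms by (auto intro: gr0I)
  moreover have "p dvd (k choose j) * fib (Suc q) ^ (j - 1) * fib q ^ (k - j) * fib j"
    if "j \<in> {2..k}" for j
  proof -
    have "p dvd fib (Suc q) ^ (j - 1)"
      using that dvd_power[of "j - 1" "fib (Suc q)"] dvd by (simp add: dvd_trans)
    then show ?thesis
      by (intro dvd_mult2 dvd_mult)
  qed
  ultimately obtain t where t: "fib (k * Suc q) = fib (Suc q) * (k * fib q ^ (k - 1) + p * t)"
    using fib_mult_split by blast
  have "\<not> p dvd k * fib q ^ (k - 1) + p * t"
    using assms p not_dvd_fib_pred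
    by (metis dvd_add_times_triv_right_iff mult.commute prime_dvd_mult_iff prime_dvd_power)
  then have "multiplicity p (k * fib q ^ (k - 1) + p * t) = 0" "k * fib q ^ (k - 1) + p * t \<noteq> 0"
    using not_dvd_imp_multiplicity_0 by (blast, metis dvd_0_right)
  then show ?thesis
    using p unfolding t
    by (simp add: prime_elem_multiplicity_mult_distrib fib_neq_0_nat del: fib.simps)
qed

text \<open>With \<open>d = p\<^sup>2\<close> the cofactor of \<open>fib (Suc q)\<close> is
  \<open>p\<close> times a number prime to \<open>p\<close>. For \<open>2 \<le> j < p\<close> one
  factor \<open>p\<close> comes from the binomial coefficient and one from
  \<open>fib (Suc q)\<close>; the assumption covers \<open>j = p\<close>. Given
  \<open>p dvd fib (Suc q)\<close>, it is a genuine restriction only for \<open>p = 2\<close>, where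
  it says \<open>4 dvd fib (Suc q)\<close>.\<close>

lemma multiplicity_fib_mult_prime:
  assumes "p\<^sup>2 dvd fib (Suc q) ^ (p - 1)"
  shows "multiplicity p (fib (p * Suc q)) = Suc (multiplicity p (fib (Suc q)))"
proof -
  have "p > 1" using p prime_gt_1_nat by blast
  moreover have "p\<^sup>2 dvd (p choose j) * fib (Suc q) ^ (j - 1) * fib q ^ (p - j) * fib j"
    if "j \<in> {2..p}" for j
  proof (cases "j = p")
    case False
    then have "p dvd p choose j" using that p by (intro dvd_choose_prime) auto
    moreover have "p dvd fib (Suc q) ^ (j - 1)"
      using that dvd_power[of "j - 1" "fib (Suc q)"] dvd by (simp add: dvd_trans)
    ultimately show ?thesis
      unfolding power2_eq_square by (intro dvd_mult2 mult_dvd_mono)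
  qed (use assms in simp)
  ultimately obtain t where "fib (p * Suc q) = fib (Suc q) * (p * fib q ^ (p - 1) + p\<^sup>2 * t)"
    using fib_mult_split[of p "p\<^sup>2"] by auto
  then have t: "fib (p * Suc q) = p * (fib (Suc q) * (fib q ^ (p - 1) + p * t))"
    by (simp add: algebra_simps power2_eq_square)
  have "\<not> p dvd fib q ^ (p - 1) + p * t"
    using p not_dvd_fib_pred
    by (metis dvd_add_times_triv_right_iff mult.commute prime_dvd_power)
  then have "multiplicity p (fib q ^ (p - 1) + p * t) = 0" "fib q ^ (p - 1) + p * t \<noteq> 0"
    using not_dvd_imp_multiplicity_0 by (blast, metis dvd_0_right)
  then show ?thesis
    using p unfolding t
    by (simp add: multiplicity_times_same prime_elem_multiplicity_mult_distrib fib_neq_0_nat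
        del: fib.simps)
qed

end

text \<open>Write \<open>k\<close> as a power of \<open>p\<close> times a part prime to
  \<open>p\<close>. Each factor \<open>p\<close> raises the valuation by one, the remaining part
  leaves it unchanged, and the divisibility hypotheses pass from \<open>fib m\<close> to
  \<open>fib\<close> of every multiple of \<open>m\<close>.\<close>

lemma multiplicity_fib_mult:
  assumes p: "prime p" and dvd: "p dvd fib m" "p\<^sup>2 dvd fib m ^ (p - 1)"
    and pos: "m > 0" "k > 0"
  shows "multiplicity p (fib (k * m)) = multiplicity p (fib m) + multiplicity p k"
proof -
  have pow: "multiplicity p (fib (p ^ r * m)) = multiplicity p (fib m) + r" for r
  proof (induction r)
    case (Suc r)
    have "p ^ r * m > 0"
      using p pos prime_gt_0_nat by simp
    then obtain q where q: "p ^ r * m = Suc q"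
      using gr0_implies_Suc by blast
    have "fib m dvd fib (Suc q)"
      by (metis q fib_dvd dvd_triv_right)
    then have "p dvd fib (Suc q)" "p\<^sup>2 dvd fib (Suc q) ^ (p - 1)"
      using dvd by (meson dvd_trans dvd_power_same)+
    then show ?case
      using multiplicity_fib_mult_prime[OF p] Suc q by (simp add: mult.assoc)
  qed simp
  obtain k' where k': "k = p ^ multiplicity p k * k'" "\<not> p dvd k'"
    using multiplicity_decompose'[of k p] p pos not_prime_unit by blast
  have "p ^ multiplicity p k * m > 0"
    using p pos prime_gt_0_nat by simp
  then obtain q where q: "p ^ multiplicity p k * m = Suc q"
    using gr0_implies_Suc by blast
  have "p dvd fib (Suc q)"
    using dvd(1) by (metis q fib_dvd dvd_triv_right dvd_trans)
  then have "multiplicity p (fib (k' * Suc q)) = multiplicity p (fib (Suc q))"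
    using multiplicity_fib_mult_coprime p k'(2) by blast
  moreover have "k' * Suc q = k * m"
    using k'(1) q by (metis mult.assoc mult.commute)
  ultimately show ?thesis
    using pow[of "multiplicity p k"] q by simp
qed

section \<open>Valuations of Fibonacci numbers at 2, 3 and 5\<close>

lemma fib_gcd_eq_1_imp_not_dvd:
  assumes "p dvd fib m" "fib (gcd m n) = 1" "p \<noteq> 1"
  shows "\<not> p dvd fib n"
  using assms by (metis fib_gcd gcd_greatest nat_dvd_1_iff_1)

lemma fib_small: "fib 3 = 2" "fib 4 = 3" "fib 5 = 5" "fib 6 = 8"
  by (simp_all add: eval_nat_numeral)

text \<open>Lifting at 2 starts from \<open>fib 6 = 8\<close>, since \<open>fib 3 = 2\<close> is not
  divisible by 4. The offset 2 is the valuation 3 of \<open>fib 6\<close> less the valuation 1 of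
  the index 6. Odd multiples of 3 keep the valuation of \<open>fib 3\<close>.\<close>

lemma multiplicity_2_fib:
  assumes "m > 0"
  shows "multiplicity 2 (fib m) =
    (if 6 dvd m then multiplicity 2 m + 2 else if 3 dvd m then 1 else 0)"
proof -
  consider k where "m = k * 6" | k where "\<not> 6 dvd m" "m = k * 3" | "\<not> 3 dvd m"
    by (metis dvd_def mult.commute)
  then show ?thesis
  proof cases
    case (1 k)
    then have "k > 0" using assms by simp
    moreover have "multiplicity 2 (8 :: nat) = 3"
      using multiplicity_prime_power[of "2 :: nat" 3] by simp
    moreover have "multiplicity 2 (k * 6) = Suc (multiplicity 2 k)"
    proof -
      have "multiplicity 2 (3 :: nat) = 0" by (rule not_dvd_imp_multiplicity_0) simp
      then show ?thesis using \<open>k > 0\<close>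
        using prime_elem_multiplicity_mult_distrib[of 2 "2 * k" 3]
          multiplicity_times_same[of k 2] by (simp add: mult.commute)
    qed
    ultimately show ?thesis
      using 1 multiplicity_fib_mult[of 2 6 k] by (simp add: fib_small)
  next
    case (2 k)
    then have "odd k" by presburger
    then have "multiplicity 2 (fib (k * 3)) = multiplicity 2 (fib 3)"
      using multiplicity_fib_mult_coprime[of 2 2 k] by (simp add: fib_small)
    then show ?thesis using 2 by (simp add: fib_small)
  next
    case 3
    then have "gcd 3 m = 1"
      by (simp add: prime_imp_coprime_nat flip: coprime_iff_gcd_eq_1)
    then have "\<not> 2 dvd fib m"
      using fib_gcd_eq_1_imp_not_dvd[of 2 3 m] by (simp add: fib_small)
    moreover have "\<not> 6 dvd m" using 3 by presburger
    ultimately show ?thesis using 3 by (simp add: not_dvd_imp_multiplicity_0)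
  qed
qed

text \<open>Lifting starts from \<open>fib 4 = 3\<close>, whose index is prime to 3. If 4 does not
  divide \<open>m\<close>, then \<open>gcd 4 m\<close> is 1 or 2, where \<open>fib\<close> is
  1.\<close>

lemma multiplicity_3_fib:
  assumes "m > 0"
  shows "multiplicity 3 (fib m) = (if 4 dvd m then multiplicity 3 m + 1 else 0)"
proof (cases "4 dvd m")
  case True
  then obtain k where k: "m = 4 * k" by blast
  have "multiplicity 3 (4 :: nat) = 0" by (rule not_dvd_imp_multiplicity_0) simp
  then have "multiplicity 3 m = multiplicity 3 k"
    using k assms by (simp add: prime_elem_multiplicity_mult_distrib)
  then show ?thesis
    using k assms multiplicity_fib_mult[of 3 4 k] by (simp add: fib_small mult.commute)
next
  case False
  have "gcd 4 m dvd 2 ^ 2" by simp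
  then obtain i where "gcd 4 m = 2 ^ i" "i \<le> 2"
    using divides_primepow_nat[of 2 "gcd 4 m" 2] by auto
  moreover have "gcd 4 m \<noteq> 2 ^ 2"
    using False gcd_dvd2[of 4 m] by fastforce
  ultimately have "gcd 4 m = 1 \<or> gcd 4 m = 2"
    by (auto simp: le_Suc_eq numeral_2_eq_2)
  then have "fib (gcd 4 m) = 1"
    by auto
  then show ?thesis
    using False fib_gcd_eq_1_imp_not_dvd[of 3 4 m]
    by (simp add: fib_small not_dvd_imp_multiplicity_0)
qed

text \<open>Lifting starts from \<open>fib 5 = 5\<close>; value and index have the same valuation,
  so no offset remains.\<close>

lemma multiplicity_5_fib:
  assumes "m > 0"
  shows "multiplicity 5 (fib m) = multiplicity 5 m"
proof (cases "5 dvd m")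
  case True
  then obtain k where "m = 5 * k" by blast
  then show ?thesis
    using assms multiplicity_fib_mult[of 5 5 k] multiplicity_times_same[of k 5]
    by (simp add: fib_small mult.commute)
next
  case False
  then have "gcd 5 m = 1"
    by (simp add: prime_imp_coprime_nat flip: coprime_iff_gcd_eq_1)
  then show ?thesis
    using False fib_gcd_eq_1_imp_not_dvd[of 5 5 m]
    by (simp add: fib_small not_dvd_imp_multiplicity_0)
qed

section \<open>Valuation sums over six consecutive indices\<close>

lemma six_consecutive: "{n..n+5} = {n, n+1, n+2, n+3, n+4, n+5}" for n :: nat
  by auto

text \<open>Reads small valuations off residues, so that the valuation sums below reduce to finitely
  many residue classes; beyond the last modulus a lower bound suffices.\<close>

lemma multiplicity_by_mod:
  fixes p x :: nat
  assumes "prime p" "x > 0"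
  shows "x mod p \<noteq> 0 \<Longrightarrow> multiplicity p x = 0"
    and "x mod p = 0 \<Longrightarrow> x mod p\<^sup>2 \<noteq> 0 \<Longrightarrow> multiplicity p x = 1"
    and "x mod p\<^sup>2 = 0 \<Longrightarrow> x mod p ^ 3 \<noteq> 0 \<Longrightarrow> multiplicity p x = 2"
    and "x mod p ^ k = 0 \<Longrightarrow> multiplicity p x \<ge> k"
proof -
  show "multiplicity p x = 0" if "x mod p \<noteq> 0"
    using that by (intro not_dvd_imp_multiplicity_0) (simp only: dvd_eq_mod_eq_0 not_False_eq_True)
  show "multiplicity p x = 1" if "x mod p = 0" "x mod p\<^sup>2 \<noteq> 0"
  proof (rule multiplicity_eqI)
    show "p ^ 1 dvd x" using that(1) by (simp only: power_one_right mod_0_imp_dvd)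
    show "\<not> p ^ Suc 1 dvd x" using that(2) by (simp only: mod_eq_0_iff_dvd Suc_1 not_False_eq_True)
  qed
  show "multiplicity p x = 2" if "x mod p\<^sup>2 = 0" "x mod p ^ 3 \<noteq> 0"
  proof (rule multiplicity_eqI)
    show "p ^ 2 dvd x" using that(1) by (rule mod_0_imp_dvd)
    show "\<not> p ^ Suc 2 dvd x"
      using that(2)
      by (simp only: mod_eq_0_iff_dvd numeral_3_eq_3 numeral_2_eq_2 not_False_eq_True)
  qed
  show "multiplicity p x \<ge> k" if "x mod p ^ k = 0"
  proof (rule multiplicity_geI)
    show "p ^ k dvd x" using that by (rule mod_0_imp_dvd)
  qed (use assms not_prime_unit in auto)
qed

lemma mod_add_mod_cancel:
  fixes n j d m :: nat
  assumes "d dvd m"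
  shows "(n mod m + j) mod d = (n + j) mod d"
  using mod_mod_cancel[OF assms, of n] mod_add_left_eq[of n d j] mod_add_left_eq[of "n mod m" d j]
  by simp

lemma six_simps:
  fixes f :: "nat \<Rightarrow> nat"
  shows sum_six: "(\<Sum>i=n..n+5. f i) = f n + f (n+1) + f (n+2) + f (n+3) + f (n+4) + f (n+5)"
    and Max_six: "Max (f ` {n..n+5}) =
      max (f n) (max (f (n+1)) (max (f (n+2)) (max (f (n+3)) (max (f (n+4)) (f (n+5))))))"
  unfolding six_consecutive by (simp_all add: add.assoc)

text \<open>Two multiples of 5 occur only when \<open>5 dvd n\<close>, namely \<open>n\<close> and
  \<open>n + 5\<close>. At most one of them is divisible by 25, so the other adds exactly 1 to the
  maximum.\<close>

lemma sum_multiplicity_5_fib: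
  assumes "n > 0"
  shows "(\<Sum>i=n..n+5. multiplicity 5 (fib i)) =
    Max (multiplicity 5 ` {n..n+5}) + (if 5 dvd n then 1 else 0)"
proof -
  \<comment> \<open>The residue modulo 25 separates valuation 1 from larger ones.\<close>
  obtain r where r: "r = n mod 25" by blast
  define v where "v j = multiplicity 5 (n + j)" for j
  have mod: "(r + j) mod 5 = (n + j) mod 5" "(r + j) mod 25 = (n + j) mod 25" for j
    by (simp_all add: r mod_add_mod_cancel)
  have v: "(r + j) mod 5 \<noteq> 0 \<Longrightarrow> v j = 0"
    "(r + j) mod 5 = 0 \<Longrightarrow> (r + j) mod 25 \<noteq> 0 \<Longrightarrow> v j = 1"
    "(r + j) mod 25 = 0 \<Longrightarrow> v j \<ge> 2" for j
    unfolding v_def mod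
    using multiplicity_by_mod(1,2)[of 5 "n + j"] multiplicity_by_mod(4)[of 5 "n + j" 2] assms
    by simp_all
  have "r < 25" using r by simp
  then have "r \<in> {0, 1, 2, 3, 4, 5, 6, 7, 8, 9, 10, 11, 12, 13, 14, 15, 16, 17, 18, 19, 20,
      21, 22, 23, 24}" by (simp only: insert_iff empty_iff) presburger
  moreover have "5 dvd n \<longleftrightarrow> r mod 5 = 0"
    by (simp add: r mod_mod_cancel dvd_eq_mod_eq_0)
  ultimately have "v 0 + v 1 + v 2 + v 3 + v 4 + v 5 =
      max (v 0) (max (v 1) (max (v 2) (max (v 3) (max (v 4) (v 5))))) + (if 5 dvd n then 1 else 0)"
    using v(3)[of 0] v(3)[of 5] by (elim insertE emptyE) (simp_all add: v(1,2))
  then show ?thesis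
    using assms by (simp only: six_simps multiplicity_5_fib v_def add_0_right add_pos_pos trans_less_add1)
qed

text \<open>\<open>M + 1\<close> is the 3-adic valuation of \<open>fib (Lcm {n..n+5})\<close>. The
  sum exceeds it, by one, exactly when two multiples of 4 occur and one of them has the maximal
  valuation \<open>M\<close>.\<close>

lemma sum_multiplicity_3_fib:
  assumes "n > 0"
  defines "S \<equiv> (\<Sum>i=n..n+5. multiplicity 3 (fib i))"
    and "M \<equiv> Max (multiplicity 3 ` {n..n+5})"
  shows "if n mod 36 \<in> {0, 11, 12, 19, 20, 31, 32, 35} then S = Suc (M + 1) else S \<le> M + 1"
proof -
  \<comment> \<open>Modulo 4 decides which indices contribute, modulo 9 separates valuation 1 from
    larger ones.\<close>
  obtain r where r: "r = n mod 36" by blast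
  define v f where "v j = multiplicity 3 (n + j)" and "f j = multiplicity 3 (fib (n + j))" for j
  have mod: "(r + j) mod 3 = (n + j) mod 3" "(r + j) mod 4 = (n + j) mod 4"
    "(r + j) mod 9 = (n + j) mod 9" for j
    by (simp_all add: r mod_add_mod_cancel)
  have v: "(r + j) mod 3 \<noteq> 0 \<Longrightarrow> v j = 0"
    "(r + j) mod 3 = 0 \<Longrightarrow> (r + j) mod 9 \<noteq> 0 \<Longrightarrow> v j = 1"
    "(r + j) mod 9 = 0 \<Longrightarrow> v j \<ge> 2" for j
    unfolding v_def mod
    using multiplicity_by_mod(1,2)[of 3 "n + j"] multiplicity_by_mod(4)[of 3 "n + j" 2] assms
    by simp_all
  have f: "f j = (if (r + j) mod 4 = 0 then v j + 1 else 0)" for j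
    unfolding v_def f_def mod using assms by (simp add: multiplicity_3_fib dvd_eq_mod_eq_0)
  have "r < 36" using r by simp
  then have "r \<in> {0, 1, 2, 3, 4, 5, 6, 7, 8, 9, 10, 11, 12, 13, 14, 15, 16, 17, 18, 19, 20,
      21, 22, 23, 24, 25, 26, 27, 28, 29, 30, 31, 32, 33, 34, 35}" by (simp only: insert_iff empty_iff) presburger
  then have "if r \<in> {0, 11, 12, 19, 20, 31, 32, 35}
    then f 0 + f 1 + f 2 + f 3 + f 4 + f 5 =
      Suc (max (v 0) (max (v 1) (max (v 2) (max (v 3) (max (v 4) (v 5))))) + 1)
    else f 0 + f 1 + f 2 + f 3 + f 4 + f 5 \<le>
      max (v 0) (max (v 1) (max (v 2) (max (v 3) (max (v 4) (v 5))))) + 1"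
    using v(3)[of 0] v(3)[of 1] v(3)[of 2] v(3)[of 3] v(3)[of 4] v(3)[of 5]
    by (elim insertE emptyE) (simp_all add: v(1,2) f)
  then show ?thesis
    by (simp only: S_def M_def six_simps v_def f_def r add_0_right)
qed

text \<open>\<open>M + 2\<close> is the 2-adic valuation of \<open>fib (Lcm {n..n+5})\<close>. The
  range holds one odd multiple of 3, contributing 1, and one multiple \<open>x\<close> of 6,
  contributing \<open>multiplicity 2 x + 2\<close>; the bound is exceeded exactly when
  \<open>x\<close> attains \<open>M\<close>.\<close>

lemma sum_multiplicity_2_fib:
  assumes "n > 0"
  defines "S \<equiv> (\<Sum>i=n..n+5. multiplicity 2 (fib i))"
    and "M \<equiv> Max (multiplicity 2 ` {n..n+5})"
  shows "if n mod 24 \<in> {0, 9, 10, 19, 20, 21, 22, 23} then S = Suc (M + 2) else S \<le> M + 2"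
proof -
  obtain r where r: "r = n mod 24" by blast
  define v f where "v j = multiplicity 2 (n + j)" and "f j = multiplicity 2 (fib (n + j))" for j
  have mod: "(r + j) mod 2 = (n + j) mod 2" "(r + j) mod 3 = (n + j) mod 3"
    "(r + j) mod 4 = (n + j) mod 4" "(r + j) mod 6 = (n + j) mod 6"
    "(r + j) mod 8 = (n + j) mod 8" for j
    by (simp_all add: r mod_add_mod_cancel)
  have v: "(r + j) mod 2 \<noteq> 0 \<Longrightarrow> v j = 0"
    "(r + j) mod 2 = 0 \<Longrightarrow> (r + j) mod 4 \<noteq> 0 \<Longrightarrow> v j = 1"
    "(r + j) mod 4 = 0 \<Longrightarrow> (r + j) mod 8 \<noteq> 0 \<Longrightarrow> v j = 2"
    "(r + j) mod 8 = 0 \<Longrightarrow> v j \<ge> 3" for j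
    unfolding v_def mod
    using multiplicity_by_mod(1-3)[of 2 "n + j"] multiplicity_by_mod(4)[of 2 "n + j" 3] assms
    by simp_all
  have f: "f j = (if (r + j) mod 6 = 0 then v j + 2 else if (r + j) mod 3 = 0 then 1 else 0)" for j
    unfolding v_def f_def mod using assms by (simp add: multiplicity_2_fib dvd_eq_mod_eq_0)
  have "r < 24" using r by simp
  then have "r \<in> {0, 1, 2, 3, 4, 5, 6, 7, 8, 9, 10, 11, 12, 13, 14, 15, 16, 17, 18, 19, 20,
      21, 22, 23}" by (simp only: insert_iff empty_iff) presburger
  then have "if r \<in> {0, 9, 10, 19, 20, 21, 22, 23}
    then f 0 + f 1 + f 2 + f 3 + f 4 + f 5 =
      Suc (max (v 0) (max (v 1) (max (v 2) (max (v 3) (max (v 4) (v 5))))) + 2)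
    else f 0 + f 1 + f 2 + f 3 + f 4 + f 5 \<le>
      max (v 0) (max (v 1) (max (v 2) (max (v 3) (max (v 4) (v 5))))) + 2"
    using v(4)[of 0] v(4)[of 1] v(4)[of 2] v(4)[of 3] v(4)[of 4] v(4)[of 5]
    by (elim insertE emptyE) (simp_all add: v(1-3) f)
  then show ?thesis
    by (simp only: S_def M_def six_simps v_def f_def r add_0_right)
qed

text \<open>
  Only one multiple of 6 occurs among \<open>n, \<dots>, n + 5\<close>. The factor 2 is needed iff it is a
  multiple of 12 whose 2-adic valuation is maximal in the range. The factor 3 is needed iff there
  are two multiples of 4, one of them is divisible by 3, and the other multiple of 3 in the range
  is not divisible by 9. The factor 5 is needed iff there are two multiples of 5.
\<close>

definition range_factor :: "nat \<Rightarrow> nat" where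
  "range_factor n =
  (if n mod 24 \<in> {0, 9, 10, 19, 20, 21, 22, 23} then 2 else 1) *
  (if n mod 36 \<in> {0, 11, 12, 19, 20, 31, 32, 35} then 3 else 1) *
  (if 5 dvd n then 5 else 1)"

section \<open>Indices whose Fibonacci number the product divides\<close>

lemma fib_eq_0_iff: "fib n = 0 \<longleftrightarrow> n = 0"
  by (cases "n = 0") (use fib_neq_0_nat[of n] in auto)

lemma Lcm_consecutive_pos: "n > 0 \<Longrightarrow> Lcm {n..n+5} > 0" for n :: nat
  by (rule gr0I) (simp add: Lcm_0_iff)

lemma fib_prod_dvd_imp_Lcm_dvd:
  assumes "n > 0" "(\<Prod>i=n..n+5. fib i) dvd fib m"
  shows "Lcm {n..n+5} dvd m"
proof (rule Lcm_least)
  have dvd: "i dvd m" if "i \<in> {n..n+5}" "i \<ge> 3" for i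
  proof -
    have "fib i dvd (\<Prod>i=n..n+5. fib i)"
      using that by (intro dvd_prodI) simp_all
    then show ?thesis
      using fib_dvd_imp_dvd[OF dvd_trans[OF _ assms(2)]] that by blast
  qed
  fix i assume i: "i \<in> {n..n+5}"
  show "i dvd m"
  proof (cases "i \<ge> 3")
    case False
    \<comment> \<open>Here \<open>n \<le> 2\<close>, so 4 lies in the range; it settles the indices
      1 and 2, about which \<open>fib 1 = fib 2 = 1\<close> says nothing.\<close>
    then have "4 dvd m"
      using i assms(1) by (intro dvd) auto
    moreover have "i = 1 \<or> i = 2"
      using False i assms(1) by auto
    ultimately show ?thesis
      using dvd_trans[of 2 4 m] by auto
  qed (use dvd i in blast)
qed

text \<open>Such a prime divides at most one of the six factors, since a common divisor of two of
  them divides \<open>fib (gcd i j)\<close>, which is 1, 2, 3 or 5. The sum is then the valuation of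
  a single divisor of \<open>fib m\<close>.\<close>

lemma sum_multiplicity_fib_le:
  assumes "prime p" "p \<noteq> 2" "p \<noteq> 3" "p \<noteq> 5" "n > 0" "m > 0" "Lcm {n..n+5} dvd m"
  shows "(\<Sum>i=n..n+5. multiplicity p (fib i)) \<le> multiplicity p (fib m)"
proof (cases "\<exists>i\<in>{n..n+5}. p dvd fib i")
  case True
  then obtain i where i: "i \<in> {n..n+5}" "p dvd fib i" by blast
  have "multiplicity p (fib j) = 0" if "j \<in> {n..n+5} - {i}" for j
  proof (rule not_dvd_imp_multiplicity_0, rule notI)
    assume "p dvd fib j"
    then have p_dvd: "p dvd fib (gcd i j)"
      using i by (simp add: fib_gcd)
    have "gcd i j dvd (if i \<le> j then j - i else i - j)"
      by (auto intro: dvd_diff_nat)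
    then have "gcd i j \<le> (if i \<le> j then j - i else i - j)"
      using that by (intro dvd_imp_le) auto
    also have "\<dots> \<le> 5"
      using that i(1) by auto
    finally have "gcd i j \<in> {1, 2, 3, 4, 5}"
      using i(1) assms(5) by (auto simp: le_Suc_eq eval_nat_numeral)
    then have "fib (gcd i j) \<in> {1, 2, 3, 5}"
      by (auto simp: fib_small)
    then show False
      using p_dvd assms(1-4) by (auto simp: primes_dvd_imp_eq)
  qed
  then have "(\<Sum>j=n..n+5. multiplicity p (fib j)) = multiplicity p (fib i)"
    using i(1) by (subst sum.remove[of _ i]) simp_all
  moreover have "fib i dvd fib m"
    using i(1) assms(7) by (intro fib_dvd) (meson dvd_Lcm dvd_trans)
  ultimately show ?thesis
    using assms(6) by (simp add: dvd_imp_multiplicity_le fib_neq_0_nat)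
next
  case False
  then show ?thesis
    by (simp add: not_dvd_imp_multiplicity_0)
qed

text \<open>Condition on \<open>k\<close> at one prime: an excess of one over \<open>M + e\<close>
  has to be made up by a factor \<open>p\<close> of \<open>k\<close>.\<close>

lemma le_add_multiplicity_iff_dvd:
  fixes p k s M e :: nat
  assumes "prime p" "k > 0" "if P then s = Suc (M + e) else s \<le> M + e"
  shows "s \<le> M + multiplicity p k + e \<longleftrightarrow> (if P then p else 1) dvd k"
proof (cases P)
  case True
  have "p dvd k \<longleftrightarrow> multiplicity p k \<ge> 1"
    using assms(1,2) power_dvd_iff_le_multiplicity[of k p 1] not_prime_unit by auto
  then show ?thesis
    using True assms(3) by auto
qed (use assms(3) in auto)

text \<open>Divisibility is compared prime by prime. Primes other than 2, 3 and 5 impose nothing on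
  \<open>k\<close>, and the three remaining conditions merge because their moduli are pairwise
  coprime.\<close>

lemma fib_prod_dvd_iff:
  assumes "n > 0" "k > 0"
  shows "(\<Prod>i=n..n+5. fib i) dvd fib (Lcm {n..n+5} * k) \<longleftrightarrow> range_factor n dvd k"
proof -
  define a where "a = Lcm {n..n+5}"
  define s where "s p = (\<Sum>i=n..n+5. multiplicity p (fib i))" for p
  have a: "a > 0"
    using assms(1) unfolding a_def by (rule Lcm_consecutive_pos)
  have s: "multiplicity p (\<Prod>i=n..n+5. fib i) = s p" if "prime p" for p
    unfolding s_def using that assms(1)
    by (intro prime_elem_multiplicity_prod_distrib) (auto simp: fib_eq_0_iff)
  have "4 dvd a" "6 dvd a"
  proof -
    have "\<exists>i\<in>{n..n+5}. d dvd i" if "d \<in> {4, 6}" for d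
    proof -
      \<comment> \<open>The witness is the largest multiple of \<open>d\<close> up to
        \<open>n + 5\<close>; \<open>d \<le> 6\<close> keeps it at least \<open>n\<close>.
        Divisibility of \<open>a\<close> by 4 and 6 selects the lifted branch of the valuation
        formulas at 3 and 2.\<close>
      have "d dvd d * ((n + 5) div d)" "d * ((n + 5) div d) \<in> {n..n+5}"
        using that mult_div_mod_eq[of d "n + 5"] mod_less_divisor[of d "n + 5"] by auto
      then show ?thesis by blast
    qed
    then show "4 dvd a" "6 dvd a"
      unfolding a_def by (meson dvd_Lcm dvd_trans insertI1 insertI2)+
  qed
  have mult: "multiplicity p (a * k) = Max (multiplicity p ` {n..n+5}) + multiplicity p k"
    if "prime p" for p
    using that a assms unfolding a_def
    by (simp add: prime_elem_multiplicity_mult_distrib multiplicity_Lcm_nat)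
  have two: "s 2 \<le> multiplicity 2 (fib (a * k)) \<longleftrightarrow>
    (if n mod 24 \<in> {0, 9, 10, 19, 20, 21, 22, 23} then 2 else 1) dvd k"
  proof -
    have "multiplicity 2 (fib (a * k)) = Max (multiplicity 2 ` {n..n+5}) + multiplicity 2 k + 2"
      using a assms(2) \<open>6 dvd a\<close> mult[of 2] by (simp add: multiplicity_2_fib)
    then show ?thesis
      using le_add_multiplicity_iff_dvd[OF _ assms(2) sum_multiplicity_2_fib[OF assms(1)]]
      by (simp only: s_def two_is_prime_nat)
  qed
  have three: "s 3 \<le> multiplicity 3 (fib (a * k)) \<longleftrightarrow>
    (if n mod 36 \<in> {0, 11, 12, 19, 20, 31, 32, 35} then 3 else 1) dvd k"
  proof -
    have "multiplicity 3 (fib (a * k)) = Max (multiplicity 3 ` {n..n+5}) + multiplicity 3 k + 1"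
      using a assms(2) \<open>4 dvd a\<close> mult[of 3] by (simp add: multiplicity_3_fib)
    moreover have "prime (3 :: nat)" by simp
    ultimately show ?thesis
      using le_add_multiplicity_iff_dvd[OF _ assms(2) sum_multiplicity_3_fib[OF assms(1)]]
      by (simp only: s_def)
  qed
  have five: "s 5 \<le> multiplicity 5 (fib (a * k)) \<longleftrightarrow> (if 5 dvd n then 5 else 1) dvd k"
  proof -
    let ?M = "Max (multiplicity 5 ` {n..n+5})"
    have prime: "prime (5 :: nat)" by simp
    have "multiplicity 5 (fib (a * k)) = ?M + multiplicity 5 k + 0"
      using a assms(2) mult[of 5] by (simp add: multiplicity_5_fib)
    moreover have "if 5 dvd n then s 5 = Suc (?M + 0) else s 5 \<le> ?M + 0"
      unfolding s_def using sum_multiplicity_5_fib[OF assms(1)] by (cases "5 dvd n") simp_all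
    ultimately show ?thesis
      using le_add_multiplicity_iff_dvd[OF prime assms(2)] by (simp only:)
  qed
  have "(\<Prod>i=n..n+5. fib i) dvd fib (a * k) \<longleftrightarrow>
    (\<forall>p. prime p \<longrightarrow> s p \<le> multiplicity p (fib (a * k)))"
    (is "?b dvd _ \<longleftrightarrow> _")
  proof -
    have "?b \<noteq> 0" "fib (a * k) \<noteq> 0"
      using a assms by (auto simp: fib_eq_0_iff)
    then show ?thesis
      using s by (metis dvd_imp_multiplicity_le multiplicity_le_imp_dvd)
  qed
  also have "\<dots> \<longleftrightarrow> (\<forall>p\<in>{2, 3, 5}. s p \<le> multiplicity p (fib (a * k)))"
  proof -
    have "s p \<le> multiplicity p (fib (a * k))" if "prime p" "p \<notin> {2, 3, 5}" for p
      using that assms a unfolding s_def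
      by (intro sum_multiplicity_fib_le) (auto simp: a_def)
    moreover have "prime p" if "p \<in> {2, 3, 5}" for p :: nat
      using that by auto
    ultimately show ?thesis by blast
  qed
  also have "\<dots> \<longleftrightarrow> range_factor n dvd k"
  proof -
    have *: "u * v * w dvd k \<longleftrightarrow> u dvd k \<and> v dvd k \<and> w dvd k"
      if "u \<in> {1, 2}" "v \<in> {1, 3}" "w \<in> {1, 5}" for u v w :: nat
    proof -
      have "coprime u v" "coprime u w" "coprime v w"
        using that by (auto simp: primes_coprime)
      then have "coprime (u * v) w"
        by simp
      then show ?thesis
        using \<open>coprime u v\<close> by (meson divides_mult dvd_mult_left dvd_mult_right)
    qed
    have "range_factor n dvd k \<longleftrightarrow>
      (if n mod 24 \<in> {0, 9, 10, 19, 20, 21, 22, 23} then 2 else 1) dvd k \<and>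
      (if n mod 36 \<in> {0, 11, 12, 19, 20, 31, 32, 35} then 3 else 1) dvd k \<and>
      (if 5 dvd n then 5 else 1) dvd k"
      unfolding range_factor_def by (rule *) simp_all
    then show ?thesis
      by (simp only: ball_simps two three five simp_thms)
  qed
  finally show ?thesis
    unfolding a_def .
qed

section \<open>The least index and its case distinction\<close>

lemma fib_order_fib_prod:
  assumes "n > 0"
  shows "fib_order (\<Prod>i=n..n+5. fib i) = Lcm {n..n+5} * range_factor n"
  unfolding fib_order_def
proof (rule Least_equality)
  have pos: "Lcm {n..n+5} > 0" "range_factor n > 0"
    using assms by (simp_all only: Lcm_consecutive_pos) (simp add: range_factor_def)
  then show "Lcm {n..n+5} * range_factor n > 0 \<and>
      (\<Prod>i=n..n+5. fib i) dvd fib (Lcm {n..n+5} * range_factor n)"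
    using assms by (simp only: fib_prod_dvd_iff nat_0_less_mult_iff dvd_refl simp_thms)
  fix m assume m: "m > 0 \<and> (\<Prod>i=n..n+5. fib i) dvd fib m"
  then obtain k where k: "m = Lcm {n..n+5} * k"
    using fib_prod_dvd_imp_Lcm_dvd assms by blast
  then have "k > 0" using m by (intro gr0I) simp
  then have "range_factor n dvd k"
    using fib_prod_dvd_iff assms m k by blast
  then show "Lcm {n..n+5} * range_factor n \<le> m"
    unfolding k using \<open>k > 0\<close> by (intro mult_le_mono2 dvd_imp_le)
qed

theorem theorem3p5:
  fixes n a b c :: nat
  assumes "n \<ge> 1"
    and "a = Lcm {n..n+5}"
    and "b = (\<Prod>i=n..n+5. fib i)"
    and "c = gcd 5 n"
  shows
    "(n mod 12 \<in> {1, 2, 3, 4, 5, 6} \<or> n mod 72 \<in> {7, 8, 59, 60}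
        \<longrightarrow> fib_order b = a * c) \<and>
     (n mod 12 \<in> {9, 10} \<or> n mod 72 \<in> {23, 24, 43, 44}
        \<longrightarrow> fib_order b = 2 * a * c) \<and>
     (n mod 72 \<in> {11, 12, 31, 32, 35, 36, 55, 56}
        \<longrightarrow> fib_order b = 3 * a * c) \<and>
     (n mod 72 \<in> {0, 19, 20, 47, 48, 67, 68, 71}
        \<longrightarrow> fib_order b = 6 * a * c)"
proof -
  \<comment> \<open>72 is the lcm of 24 and 36, the moduli governing the factors 2 and 3; the factor
    5 is exactly \<open>c\<close>.\<close>
  obtain r where r: "r = n mod 72" by blast
  have mod: "n mod 12 = r mod 12" "n mod 24 = r mod 24" "n mod 36 = r mod 36"
    by (simp_all add: r mod_mod_cancel)
  have c: "c = (if 5 dvd n then 5 else 1)"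
  proof (cases "5 dvd n")
    case False
    then have "coprime 5 n" by (intro prime_imp_coprime_nat) simp_all
    then show ?thesis using False assms(4) by simp
  qed (use assms(4) in \<open>simp add: gcd_nat.absorb1\<close>)
  have order: "fib_order b = a * c *
      ((if r mod 24 \<in> {0, 9, 10, 19, 20, 21, 22, 23} then 2 else 1) *
       (if r mod 36 \<in> {0, 11, 12, 19, 20, 31, 32, 35} then 3 else 1))"
    using fib_order_fib_prod[of n] assms(1)
    unfolding assms(2,3) range_factor_def c mod by (simp only: mult_ac)
  have "r < 72" using r by simp
  then have "r \<in> {0, 1, 2, 3, 4, 5, 6, 7, 8, 9, 10, 11, 12, 13, 14, 15, 16, 17, 18, 19, 20,
      21, 22, 23, 24, 25, 26, 27, 28, 29, 30, 31, 32, 33, 34, 35, 36, 37, 38, 39,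
      40, 41, 42, 43, 44, 45, 46, 47, 48, 49, 50, 51, 52, 53, 54, 55, 56, 57, 58,
      59, 60, 61, 62, 63, 64, 65, 66, 67, 68, 69, 70, 71}"
    by (simp only: insert_iff empty_iff) presburger
  then show ?thesis
    unfolding order mod(1) r[symmetric] by (elim insertE emptyE) (simp_all add: mult_ac)
qed

end
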